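(* Let $z^\star\in\mathbb{T}^n$, let $\Delta\in\mathbb{C}^{n\times n}$ be a Hermitian matrix with zero diagonal, and let $C=(z^\star)(z^\star)^H+\Delta$. Suppose that (i) $\|\Delta\|_{\rm op}\le \frac{n}{16}$, (ii) the step size $\alpha$ satisfies $\alpha\ge 2$, and (iii) the initial point is $z^0=v_C$ (the eigenvector estimator of $C$). Then the sequence of iterates $\{z^k\}_{k\ge 0}$ generated by the generalized power method with objective matrix $C$, step size $\alpha$ and initial point $z^0$ satisfies $$ d_2(z^{k+1},z^\star) \le \mu^{k+1}\cdot d_2(z^0,z^\star) + \frac{\nu}{1-\mu}\,\frac{8\|\Delta\|_{\rm op}}{\sqrt{n}} \le \left(\mu^{k+1}+\frac{\nu}{1-\mu}\right)\frac{8\|\Delta\|_{\rm op}}{\sqrt{n}} $$ for $k=0,1,\ldots$, where $$ \mu=\frac{16(\alpha\|\Delta\|_{\rm op}+n)}{(7\alpha+8)n}<1,\qquad \nu=\frac{2\alpha}{7\alpha+8}. $$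
   Context: $\mathbb{T}^n=\{w\in\mathbb{C}^n: |w_1|=\cdots=|w_n|=1\}$; $(\cdot)^H$ is the Hermitian transpose; $\|\cdot\|_{\rm op}$ is the operator norm. For $v\in\mathbb{C}^n$, $\frac{v}{|v|}\in\mathbb{C}^n$ is the vector with $j$-th entry $v_j/|v_j|$ if $v_j\ne 0$ and $0$ otherwise. Distance: for $q\in[1,\infty]$, $d_q(w,z)=\min_{\theta\in[0,2\pi)}\|w-e^{i\theta}z\|_q$ (the same formula is used should an iterate have a zero entry). Generalized power method: given a Hermitian matrix $C\in\mathbb{C}^{n\times n}$, a step size $\alpha>0$ and an initial point $z^0\in\mathbb{T}^n$, the iterates are defined for $k=0,1,\ldots$ by $w^k=\left(I+\frac{\alpha}{n}C\right)z^k$, $z^{k+1}=\frac{w^k}{|w^k|}$ (run without termination). Eigenvector estimator: let $u\in\mathbb{C}^n$ be a leading eigenvector of $C$ (an eigenvector for the largest eigenvalue) and let $a\in\mathbb{C}^n$ be any vector with $a^Hu\ne 0$. Then $v_C\in\mathbb{T}^n$ is defined by $(v_C)_j=\frac{u_j}{|u_j|}$ if $u_j\ne0$ and $(v_C)_j=\frac{a^Hu}{|a^Hu|}$ otherwise, $j=1,\dots,n$. *)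

theory Defs
  imports "HOL-Analysis.Analysis"
begin

definition torus :: "(complex ^ 'n) set" where
  "torus = {w. \<forall>j. cmod (w $ j) = 1}"

definition herm_transpose :: "complex ^ 'n ^ 'm \<Rightarrow> complex ^ 'm ^ 'n" where
  "herm_transpose A = (\<chi> i j. cnj (A $ j $ i))"

definition hermitian :: "complex ^ 'n ^ 'n \<Rightarrow> bool" where
  "hermitian A \<longleftrightarrow> herm_transpose A = A"

text \<open>The scalar \<open>a\<^sup>H u\<close>, conjugate-linear in the first argument. (The library's \<open>inner\<close> on
  complex vectors is only its real part.)\<close>

definition herm_inner :: "complex ^ 'n \<Rightarrow> complex ^ 'n \<Rightarrow> complex" where
  "herm_inner a u = (\<Sum>j\<in>UNIV. cnj (a $ j) * u $ j)"

text \<open>The rank-one matrix \<open>w z\<^sup>H\<close>.\<close>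

definition outer_prod :: "complex ^ 'n \<Rightarrow> complex ^ 'm \<Rightarrow> complex ^ 'm ^ 'n" where
  "outer_prod w z = (\<chi> i j. w $ i * cnj (z $ j))"

text \<open>\<^const>\<open>norm\<close> on \<^typ>\<open>complex ^ 'n\<close> is the Euclidean norm, so this is the spectral norm. Although
  \<^const>\<open>onorm\<close> is phrased for real-linear maps, it is the supremum of \<open>norm (A *v x) / norm x\<close>
  over all complex vectors \<open>x\<close>.\<close>

abbreviation op_norm :: "complex ^ 'n ^ 'm \<Rightarrow> real" where
  "op_norm A \<equiv> onorm (\<lambda>x. A *v x)"

definition eigenpair :: "complex ^ 'n ^ 'n \<Rightarrow> complex \<Rightarrow> complex ^ 'n \<Rightarrow> bool" where
  "eigenpair A l v \<longleftrightarrow> v \<noteq> 0 \<and> A *v v = l *s v"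

text \<open>For use with Hermitian matrices, all of whose eigenvalues are real; hence the
  restriction to real eigenvalues in the comparison loses nothing.\<close>

definition leading_eigenvector :: "complex ^ 'n ^ 'n \<Rightarrow> complex ^ 'n \<Rightarrow> bool" where
  "leading_eigenvector A u \<longleftrightarrow>
     (\<exists>l::real. eigenpair A (of_real l) u \<and>
        (\<forall>(m::real) v. eigenpair A (of_real m) v \<longrightarrow> m \<le> l))"

definition normalize_entries :: "complex ^ 'n \<Rightarrow> complex ^ 'n" where
  "normalize_entries v =
     (\<chi> j. if v $ j \<noteq> 0 then v $ j / of_real (cmod (v $ j)) else 0)"

definition eig_estimator :: "complex ^ 'n \<Rightarrow> complex ^ 'n \<Rightarrow> complex ^ 'n" where
  "eig_estimator a u =
     (\<chi> j. if u $ j \<noteq> 0 then u $ j / of_real (cmod (u $ j))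
           else herm_inner a u / of_real (cmod (herm_inner a u)))"

text \<open>The infimum is attained, as shown by \<open>d2_attained\<close> below, so it is the minimum.\<close>

definition d2 :: "complex ^ 'n \<Rightarrow> complex ^ 'n \<Rightarrow> real" where
  "d2 w z = (INF \<theta>\<in>{0..<2*pi}. norm (w - cis \<theta> *s z))"

lemma d2_attained:
  fixes w z :: "complex ^ 'n"
  shows "\<exists>\<theta>\<in>{0..<2*pi}. d2 w z = norm (w - cis \<theta> *s z) \<and>
           (\<forall>\<phi>\<in>{0..<2*pi}. norm (w - cis \<theta> *s z) \<le> norm (w - cis \<phi> *s z))"
proof -
  let ?f = "\<lambda>\<theta>. norm (w - cis \<theta> *s z)"
  have "continuous_on {0..2*pi} ?f"
    unfolding vector_scalar_mult_def cis_conv_exp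
    by (intro continuous_intros)
  then obtain t where t: "t \<in> {0..2*pi}" "\<And>y. y \<in> {0..2*pi} \<Longrightarrow> ?f t \<le> ?f y"
    using continuous_attains_inf[of "{0..2*pi}" ?f] by auto
  define s where "s = (if t = 2*pi then 0 else t)"
  have s: "s \<in> {0..<2*pi}" "?f s = ?f t"
    using t(1) by (auto simp: s_def)
  have min: "\<forall>\<phi>\<in>{0..<2*pi}. ?f s \<le> ?f \<phi>"
    using t(2) s(2) by auto
  have "d2 w z = ?f s"
    unfolding d2_def using s(1) min
    by (intro cInf_eq_minimum) auto
  with s(1) min show ?thesis by blast
qed

primrec gpm :: "complex ^ 'n ^ 'n \<Rightarrow> real \<Rightarrow> complex ^ 'n \<Rightarrow> nat \<Rightarrow> complex ^ 'n" where
  "gpm C \<alpha> z0 0 = z0"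
| "gpm C \<alpha> z0 (Suc k) =
     normalize_entries ((mat 1 + (\<alpha> / real CARD('n)) *\<^sub>R C) *v gpm C \<alpha> z0 k)"

end

theory Submission
  imports Defs
begin

text \<open>
  Rounding an entry to the unit circle at most doubles its distance to a point of the circle.
  Write \<open>y = p z\<close> for the optimally rotated ground truth and \<open>c = \<bar>z\<^sup>H x\<bar> / n\<close>. One step of the power
  method produces \<open>(\<alpha> c + 1) y + (x - y) + (\<alpha> / n) \<Delta> (x - y) + (\<alpha> / n) \<Delta> y\<close> before rounding, and
  dividing by \<open>\<alpha> c + 1\<close> gives a contraction towards \<open>y\<close> up to noise. If \<open>c \<ge> 7/8\<close>, then
  \<open>\<alpha> c + 1 \<ge> (7 \<alpha> + 8) / 8\<close>, which yields the constants \<open>\<mu>\<close> and \<open>\<nu>\<close>; as \<open>\<mu> + \<nu> \<le> 1\<close> for \<open>\<alpha> \<ge> 2\<close>, the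
  condition \<open>c \<ge> 7/8\<close> is preserved. It holds initially because comparing the Rayleigh quotients of
  \<open>C\<close> at its leading eigenvector \<open>u\<close> and at \<open>y\<close> bounds \<open>\<parallel>u - y\<parallel> \<parallel>u + y\<parallel>\<close> by \<open>4 \<parallel>\<Delta>\<parallel>\<close>.
\<close>

section \<open>Hermitian products, norms and matrices\<close>

lemma inner_complex_vec: "inner x y = Re (herm_inner x y)"
  unfolding herm_inner_def by (simp add: inner_vec_def inner_complex_def)

lemma herm_inner_scale_left: "herm_inner (p *s x) y = cnj p * herm_inner x y"
  unfolding herm_inner_def by (simp add: sum_distrib_left mult.assoc)

lemma norm_complex_vector_scale:
  fixes x :: "complex ^ 'n"
  shows "norm (p *s x) = cmod p * norm x"
  by (simp add: norm_vec_def L2_set_right_distrib norm_mult)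

lemma norm_torus: "w \<in> torus \<Longrightarrow> (norm w)\<^sup>2 = real CARD('n)"
  for w :: "complex ^ 'n"
  by (simp add: torus_def norm_vec_def L2_set_def)

lemma norm_le_unit_entries:
  fixes w :: "complex ^ 'n"
  assumes "\<And>j. cmod (w $ j) \<le> 1"
  shows "(norm w)\<^sup>2 \<le> real CARD('n)"
proof -
  have "(norm w)\<^sup>2 = (\<Sum>j\<in>UNIV. (cmod (w $ j))\<^sup>2)"
    by (simp add: norm_vec_def L2_set_def sum_nonneg)
  also have "\<dots> \<le> (\<Sum>j\<in>(UNIV::'n set). 1)"
    by (intro sum_mono) (simp add: assms power_le_one)
  finally show ?thesis by simp
qed

lemma torus_scale: "cmod p = 1 \<Longrightarrow> z \<in> torus \<Longrightarrow> p *s z \<in> torus"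
  by (simp add: torus_def norm_mult)

lemma norm_matrix_le_op_norm: "norm (A *v x) \<le> op_norm A * norm x"
  for A :: "complex ^ 'n ^ 'm"
  by (rule onorm[OF matrix_vector_mul_bounded_linear])

lemma op_norm_nonneg: "0 \<le> op_norm A"
  for A :: "complex ^ 'n ^ 'm"
  by (rule onorm_pos_le[OF matrix_vector_mul_bounded_linear])

lemma matrix_mult_scaleR_right: "A *v (r *\<^sub>R x) = r *\<^sub>R (A *v x)"
  for A :: "complex ^ 'n ^ 'm"
  by (rule linear_scale[OF matrix_vector_mul_linear])

lemma outer_prod_mult: "outer_prod w z *v x = herm_inner z x *s w"
  by (simp add: vec_eq_iff matrix_vector_mult_def outer_prod_def herm_inner_def
      sum_distrib_left mult_ac)

lemma hermitian_outer_prod_self: "hermitian (outer_prod z z)"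
  by (simp add: hermitian_def herm_transpose_def outer_prod_def vec_eq_iff)

lemma hermitian_add: "hermitian A \<Longrightarrow> hermitian B \<Longrightarrow> hermitian (A + B)"
  by (simp add: hermitian_def herm_transpose_def vec_eq_iff)

text \<open>The real part of the sesquilinear identity. It makes a Hermitian matrix self-adjoint for
  the real \<open>inner\<close>, so arguments for real inner product spaces apply.\<close>

lemma hermitian_inner_commute:
  assumes "hermitian A"
  shows "inner x (A *v y) = inner (A *v x) y"
proof -
  have *: "cnj (A $ i $ j) = A $ j $ i" for i j
    using assms by (simp add: hermitian_def herm_transpose_def vec_eq_iff)
  have "herm_inner x (A *v y) = (\<Sum>i\<in>UNIV. \<Sum>j\<in>UNIV. cnj (x $ i) * (A $ i $ j * y $ j))"
    by (simp add: herm_inner_def matrix_vector_mult_def sum_distrib_left)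
  also have "\<dots> = (\<Sum>j\<in>UNIV. \<Sum>i\<in>UNIV. cnj (x $ i) * (A $ i $ j * y $ j))"
    by (rule sum.swap)
  also have "\<dots> = herm_inner (A *v x) y"
    by (simp add: herm_inner_def matrix_vector_mult_def sum_distrib_left sum_distrib_right * mult_ac)
  finally show ?thesis by (simp add: inner_complex_vec)
qed

section \<open>Rayleigh quotients of Hermitian matrices\<close>

text \<open>The form attains its minimum 0 at \<open>v\<close>. Moving from \<open>v\<close> along
  \<open>- f v\<close> lowers it to first order by \<open>2 * t * b\<close>, so a nonzero
  \<open>f v\<close> would make it negative.\<close>

lemma nonneg_form_zero_imp_kernel:
  fixes f :: "'a::real_inner \<Rightarrow> 'a"
  assumes lin: "linear f"
    and sym: "\<And>x y. inner x (f y) = inner (f x) y"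
    and nonneg: "\<And>x. 0 \<le> inner x (f x)"
    and zero: "inner v (f v) = 0"
  shows "f v = 0"
proof (rule ccontr)
  assume ne: "f v \<noteq> 0"
  define b where "b = inner (f v) (f v)"
  define c where "c = inner (f v) (f (f v))"
  have b: "b > 0" using ne by (simp add: b_def)
  have c: "c \<ge> 0" using nonneg by (simp add: c_def)
  \<comment> \<open>This choice gives \<open>t * c \<le> b\<close>, so the linear term beats the
    quadratic one; the added 1 covers \<open>c = 0\<close>.\<close>
  define t where "t = b / (c + 1)"
  have "0 \<le> inner (v - t *\<^sub>R f v) (f (v - t *\<^sub>R f v))" by (rule nonneg)
  also have "\<dots> = t\<^sup>2 * c - 2 * t * b"
    using sym[of v "f v"] zero
    by (simp add: linear_diff[OF lin] linear_scale[OF lin] inner_diff b_def c_def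
        power2_eq_square algebra_simps)
  also have "\<dots> = t * (t * c - 2 * b)" by (simp add: power2_eq_square algebra_simps)
  finally have *: "0 \<le> t * (t * c - 2 * b)" .
  have "t > 0" using b c by (simp add: t_def)
  moreover have "t * c \<le> b" using b c by (simp add: t_def field_simps)
  ultimately have "t * (t * c - 2 * b) < 0" using b by (intro mult_pos_neg) auto
  with * show False by simp
qed

text \<open>The form of \<open>A\<close> has a maximiser \<open>v\<close> on the compact unit
  sphere. The form of m I - A is then nonnegative and vanishes at \<open>v\<close>, which puts
  \<open>v\<close> in the kernel of m I - A.\<close>

lemma hermitian_max_eigenpair:
  fixes A :: "complex ^ 'n ^ 'n"
  assumes "hermitian A"
  obtains m v where "eigenpair A (of_real m) v"
    and "\<And>x. inner x (A *v x) \<le> m * (norm x)\<^sup>2"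
proof -
  let ?S = "sphere (0::complex ^ 'n) 1"
  have cont: "continuous_on ?S (\<lambda>x. inner x (A *v x))"
    by (intro continuous_on_inner continuous_on_id
        bounded_linear.continuous_on[OF matrix_vector_mul_bounded_linear])
  have "axis undefined 1 \<in> ?S" by (simp add: norm_axis_1)
  then obtain v where v: "v \<in> ?S" and max: "\<And>x. x \<in> ?S \<Longrightarrow> inner x (A *v x) \<le> inner v (A *v v)"
    using continuous_attains_sup[OF compact_sphere _ cont] by blast
  define m where "m = inner v (A *v v)"
  have le: "inner x (A *v x) \<le> m * (norm x)\<^sup>2" for x
  proof (cases "x = 0")
    case False
    define y where "y = (1 / norm x) *\<^sub>R x"
    have "y \<in> ?S" using False by (simp add: y_def)
    from max[OF this] have "inner y (A *v y) \<le> m" by (simp add: m_def)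
    moreover have "x = norm x *\<^sub>R y" using False by (simp add: y_def)
    then have "inner x (A *v x) = (norm x)\<^sup>2 * inner y (A *v y)"
      by (metis inner_scaleR_left inner_scaleR_right matrix_mult_scaleR_right mult.assoc power2_eq_square)
    ultimately show ?thesis by (simp add: mult.commute[of m] mult_left_mono)
  qed simp
  have lin: "linear (\<lambda>x. A *v x)"
    by (rule matrix_vector_mul_linear)
  have "m *\<^sub>R v - A *v v = 0"
  proof (rule nonneg_form_zero_imp_kernel[where f = "\<lambda>x. m *\<^sub>R x - A *v x"])
    show "linear (\<lambda>x. m *\<^sub>R x - A *v x)"
      by (intro linear_compose_sub linear_compose_scale_right linear_ident lin)
    show "inner x (m *\<^sub>R y - A *v y) = inner (m *\<^sub>R x - A *v x) y" for x y
      using hermitian_inner_commute[OF assms, of x y] by (simp add: inner_diff)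
    show "0 \<le> inner x (m *\<^sub>R x - A *v x)" for x
      using le[of x] by (simp add: inner_diff power2_norm_eq_inner)
    have "inner v v = 1" using v by (simp add: norm_eq_1)
    then show "inner v (m *\<^sub>R v - A *v v) = 0" by (simp add: inner_diff m_def)
  qed
  then have "A *v v = of_real m *s v"
    by (simp add: vec_eq_iff) (simp add: scaleR_conv_of_real)
  moreover have "v \<noteq> 0" using v by auto
  ultimately show ?thesis using le that by (auto simp: eigenpair_def)
qed

text \<open>\<open>leading_eigenvector\<close> compares eigenvalues only; the eigenpair of
  \<open>hermitian_max_eigenpair\<close> extends the comparison to all vectors.\<close>

lemma leading_eigenvector_rayleigh:
  assumes "hermitian A" and "leading_eigenvector A u"
  shows "inner x (A *v x) * (norm u)\<^sup>2 \<le> inner u (A *v u) * (norm x)\<^sup>2"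
proof -
  obtain l :: real where l: "eigenpair A (of_real l) u"
    and lmax: "\<And>m v. eigenpair A (of_real m) v \<Longrightarrow> m \<le> l"
    using assms(2) unfolding leading_eigenvector_def by blast
  obtain m v where mv: "eigenpair A (of_real m) v" "\<And>x. inner x (A *v x) \<le> m * (norm x)\<^sup>2"
    using hermitian_max_eigenpair[OF assms(1)] by metis
  have "of_real l *s u = l *\<^sub>R u"
    by (simp add: vec_eq_iff) (simp add: scaleR_conv_of_real)
  then have u: "inner u (A *v u) = l * (norm u)\<^sup>2"
    using l by (simp add: eigenpair_def power2_norm_eq_inner)
  have "inner x (A *v x) \<le> l * (norm x)\<^sup>2"
    using mv(2)[of x] mult_right_mono[OF lmax[OF mv(1)], of "(norm x)\<^sup>2"] by simp
  then have "inner x (A *v x) * (norm u)\<^sup>2 \<le> l * (norm x)\<^sup>2 * (norm u)\<^sup>2"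
    by (rule mult_right_mono) simp
  then show ?thesis by (simp add: u mult_ac)
qed

section \<open>Optimal phase, distance and correlation gap\<close>

lemma d2_le:
  assumes "cmod p = 1"
  shows "d2 w z \<le> norm (w - p *s z)"
proof -
  have "p = cis (Arg2pi p)" using Arg2pi_eq[of p] assms by (simp add: cis_conv_exp)
  moreover have "Arg2pi p \<in> {0..<2*pi}" using Arg2pi[of p] by simp
  ultimately show ?thesis using d2_attained[of w z] by metis
qed

text \<open>In the expanded square of \<open>norm (x - q *s z)\<close> only
  \<open>Re (cnj q * h)\<close> depends on the unit phase \<open>q\<close>, and it is largest when
  \<open>q\<close> is the phase of \<open>h\<close>.\<close>

lemma d2_optimal_phase:
  fixes z x :: "complex ^ 'n"
  obtains p where "cmod p = 1" "d2 x z = norm (x - p *s z)"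
    "herm_inner z x = of_real (cmod (herm_inner z x)) * p"
proof -
  define h where "h = herm_inner z x"
  \<comment> \<open>If \<open>h = 0\<close>, all phases are equally good and any unit value
    satisfies \<open>hp\<close>.\<close>
  define p where "p = (if h = 0 then 1 else sgn h)"
  have p: "cmod p = 1" by (simp add: p_def norm_sgn)
  have hp: "h = of_real (cmod h) * p" by (auto simp: p_def sgn_eq)
  have ex: "(norm (x - q *s z))\<^sup>2 = (norm x)\<^sup>2 + (norm z)\<^sup>2 - 2 * Re (cnj q * h)"
    if "cmod q = 1" for q
  proof -
    have "(norm (x - q *s z))\<^sup>2 = (norm x)\<^sup>2 + (norm (q *s z))\<^sup>2 - 2 * inner (q *s z) x"
      by (simp add: power2_norm_eq_inner inner_diff inner_commute)
    also have "\<dots> = (norm x)\<^sup>2 + (norm z)\<^sup>2 - 2 * Re (cnj q * h)"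
      by (simp add: norm_complex_vector_scale that inner_complex_vec herm_inner_scale_left h_def)
    finally show ?thesis .
  qed
  have "cnj p * h = of_real (cmod h) * (p * cnj p)" by (subst hp) (simp add: mult_ac)
  also have "\<dots> = of_real (cmod h)" by (simp add: complex_norm_square[symmetric] p)
  finally have ph: "Re (cnj p * h) = cmod h" by simp
  obtain t where t: "d2 x z = norm (x - cis t *s z)" using d2_attained[of x z] by blast
  have "Re (cnj (cis t) * h) \<le> cmod h"
    using complex_Re_le_cmod[of "cnj (cis t) * h"] by (simp add: norm_mult)
  then have "(norm (x - p *s z))\<^sup>2 \<le> (norm (x - cis t *s z))\<^sup>2"
    using ex[OF p] ex[of "cis t"] ph by simp
  then have "norm (x - p *s z) \<le> d2 x z" unfolding t by (rule power2_le_imp_le) simp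
  then have "d2 x z = norm (x - p *s z)" using d2_le[OF p, of x z] by simp
  with p hp show ?thesis using that unfolding h_def by blast
qed

lemma inner_scale_phase:
  assumes "cmod p = 1" and "herm_inner z x = of_real (cmod (herm_inner z x)) * p"
  shows "inner (p *s z) x = cmod (herm_inner z x)"
proof -
  have "herm_inner (p *s z) x = of_real (cmod (herm_inner z x)) * (p * cnj p)"
    unfolding herm_inner_scale_left by (subst assms(2)) (simp only: mult_ac)
  also have "\<dots> = of_real (cmod (herm_inner z x))"
    by (simp add: complex_norm_square[symmetric] assms(1))
  finally show ?thesis by (simp add: inner_complex_vec)
qed

lemma outer_prod_phase:
  assumes "herm_inner z x = of_real (cmod (herm_inner z x)) * p"
  shows "outer_prod z z *v x = cmod (herm_inner z x) *\<^sub>R (p *s z)"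
proof -
  have "outer_prod z z *v x = (of_real (cmod (herm_inner z x)) * p) *s z"
    unfolding outer_prod_mult by (subst assms) (rule refl)
  then show ?thesis by (simp add: vec_eq_iff) (simp add: scaleR_conv_of_real mult_ac)
qed

lemma d2_nonneg: "0 \<le> d2 x z"
  using d2_attained[of x z] by (metis norm_ge_zero)

text \<open>An iterate may have zero entries, and then \<open>d2\<close> does not determine the correlation
  \<open>z\<^sup>H x\<close>. The correlation gap \<open>2 n - 2 \<bar>z\<^sup>H x\<bar>\<close> is the quantity that can be propagated; it equals
  the squared distance when \<open>x\<close> lies on the torus.\<close>

definition corr_gap :: "complex ^ 'n \<Rightarrow> complex ^ 'n \<Rightarrow> real" where
  "corr_gap x z = 2 * real CARD('n) - 2 * cmod (herm_inner z x)"

lemma d2_sq_le_corr_gap: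
  fixes x z :: "complex ^ 'n"
  assumes "z \<in> torus" and "\<And>j. cmod (x $ j) \<le> 1"
  shows "(d2 x z)\<^sup>2 \<le> corr_gap x z"
proof -
  obtain p where p: "cmod p = 1" "d2 x z = norm (x - p *s z)"
    "herm_inner z x = of_real (cmod (herm_inner z x)) * p"
    by (rule d2_optimal_phase)
  have "(d2 x z)\<^sup>2 = (norm x)\<^sup>2 + (norm (p *s z))\<^sup>2 - 2 * inner (p *s z) x"
    unfolding p(2) by (simp add: power2_norm_eq_inner inner_diff inner_commute)
  also have "\<dots> \<le> corr_gap x z"
    using norm_le_unit_entries[OF assms(2)] norm_torus[OF torus_scale[OF p(1) assms(1)]]
    by (simp add: corr_gap_def inner_scale_phase[OF p(1,3)])
  finally show ?thesis .
qed

section \<open>Entrywise rounding to the circle\<close>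

text \<open>For nonzero \<open>x\<close>, the left side is the squared distance of \<open>v\<close>
  and \<open>y\<close>, and \<open>v\<close> is the point of the circle nearest to \<open>x\<close>,
  so the triangle inequality gives the factor 2. For \<open>x = 0\<close> the right side is 4,
  enough for any \<open>v\<close> in the unit disc.\<close>

lemma unit_rounding_entry:
  fixes x y v :: complex
  assumes v: "cmod v \<le> 1" and y: "cmod y = 1" and sgn: "x \<noteq> 0 \<Longrightarrow> v = sgn x"
  shows "2 - 2 * inner y v \<le> 4 * (cmod (x - y))\<^sup>2"
proof (cases "x = 0")
  case True
  have "\<bar>inner y v\<bar> \<le> 1" using Cauchy_Schwarz_ineq2[of y v] v y by simp
  then show ?thesis using True y by simp
next
  case False
  then have vs: "v = sgn x" and v1: "cmod v = 1" using sgn by (auto simp: norm_sgn)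
  have "x = cmod x *\<^sub>R v" using False by (simp add: vs sgn_div_norm)
  then have "v - x = (1 - cmod x) *\<^sub>R v" by (simp add: algebra_simps)
  then have "cmod (v - x) = \<bar>cmod y - cmod x\<bar>" by (simp add: v1 y)
  then have "cmod (v - x) \<le> cmod (x - y)" using norm_triangle_ineq3[of x y] by simp
  then have "cmod (v - y) \<le> 2 * cmod (x - y)" using norm_triangle_ineq[of "v - x" "x - y"] by simp
  then have "(cmod (v - y))\<^sup>2 \<le> (2 * cmod (x - y))\<^sup>2" by (rule power_mono) simp
  moreover have "(cmod (v - y))\<^sup>2 = (cmod v)\<^sup>2 + (cmod y)\<^sup>2 - 2 * inner y v"
    by (simp only: power2_norm_eq_inner inner_diff inner_commute[of v y])
  ultimately show ?thesis by (simp add: v1 y power_mult_distrib)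
qed

text \<open>Leaving \<open>v\<close> free in the unit disc where \<open>x\<close> vanishes covers
  both conventions: the unit phase in \<open>eig_estimator\<close> and the 0 in
  \<open>normalize_entries\<close>.\<close>

lemma corr_gap_rounding:
  fixes x y z v :: "complex ^ 'n"
  assumes z: "z \<in> torus" and p: "cmod p = 1"
    and v: "\<And>j. cmod (v $ j) \<le> 1" and sgn: "\<And>j. x $ j \<noteq> 0 \<Longrightarrow> v $ j = sgn (x $ j)"
  shows "corr_gap v z \<le> (2 * norm (x - p *s z))\<^sup>2"
proof -
  let ?y = "p *s z"
  have y: "cmod (?y $ j) = 1" for j using torus_scale[OF p z] by (simp add: torus_def)
  have "inner ?y v \<le> cmod (herm_inner z v)"
    using complex_Re_le_cmod[of "herm_inner ?y v"]
    by (simp add: inner_complex_vec herm_inner_scale_left norm_mult p)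
  then have "corr_gap v z \<le> 2 * real CARD('n) - 2 * inner ?y v" by (simp add: corr_gap_def)
  also have "\<dots> = (\<Sum>j\<in>UNIV. 2 - 2 * inner (?y $ j) (v $ j))"
    by (simp only: inner_vec_def sum_subtractf sum_distrib_left[symmetric]) simp
  also have "\<dots> \<le> (\<Sum>j\<in>UNIV. 4 * (cmod (x $ j - ?y $ j))\<^sup>2)"
    by (intro sum_mono unit_rounding_entry v y sgn)
  also have "\<dots> = (2 * norm (x - ?y))\<^sup>2"
    by (simp add: norm_vec_def L2_set_def sum_nonneg power_mult_distrib sum_distrib_left)
  finally show ?thesis .
qed

section \<open>Accuracy of the eigenvector estimator\<close>

lemma spectral_perturbation:
  fixes u z :: "complex ^ 'n"
  assumes z: "z \<in> torus" and herm: "hermitian \<Delta>"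
    and u: "leading_eigenvector (outer_prod z z + \<Delta>) u"
    and norm_u: "(norm u)\<^sup>2 = real CARD('n)"
    and p: "cmod p = 1" and ph: "herm_inner z u = of_real (cmod (herm_inner z u)) * p"
  shows "norm (u - p *s z) \<le> 4 * op_norm \<Delta> / sqrt (real CARD('n))"
proof -
  define n where "n = real CARD('n)"
  define D where "D = op_norm \<Delta>"
  define y where "y = p *s z"
  define c where "c = cmod (herm_inner z u)"
  have n: "n > 0" by (simp add: n_def)
  have D: "D \<ge> 0" by (simp add: D_def op_norm_nonneg)
  have norm_y: "(norm y)\<^sup>2 = n"
    using norm_torus[OF torus_scale[OF p z]] by (simp add: y_def n_def)
  have c: "inner y u = c" using inner_scale_phase[OF p ph] by (simp add: y_def c_def)
  have c0: "c \<ge> 0" by (simp add: c_def)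
  have zy: "herm_inner z y = of_real n * p"
  proof -
    have "herm_inner z y = p * (\<Sum>j\<in>UNIV. (z $ j) * cnj (z $ j))"
      by (simp add: herm_inner_def y_def sum_distrib_left mult_ac)
    also have "\<dots> = p * of_real n"
      using z by (simp add: torus_def n_def complex_norm_square[symmetric])
    finally show ?thesis by simp
  qed
  have outer_u: "inner u (outer_prod z z *v u) = c\<^sup>2"
    using c by (simp add: outer_prod_phase[OF ph] c_def[symmetric] y_def[symmetric]
        inner_commute power2_eq_square)
  have "cmod (herm_inner z y) = n" using n by (simp add: zy norm_mult p)
  then have "outer_prod z z *v y = n *\<^sub>R y"
    using outer_prod_phase[of z y p] zy by (simp only: y_def)
  then have outer_y: "inner y (outer_prod z z *v y) = n\<^sup>2"
    using norm_y unfolding power2_norm_eq_inner by (simp add: power2_eq_square)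
  have "inner y ((outer_prod z z + \<Delta>) *v y) \<le> inner u ((outer_prod z z + \<Delta>) *v u)"
    using leading_eigenvector_rayleigh[OF hermitian_add[OF hermitian_outer_prod_self herm] u, of y]
      norm_y norm_u n by (simp add: n_def)
  then have "n\<^sup>2 + inner y (\<Delta> *v y) \<le> c\<^sup>2 + inner u (\<Delta> *v u)"
    by (simp add: matrix_vector_mult_add_rdistrib inner_add outer_u outer_y)
  \<comment> \<open>The difference of two quadratic forms factors because the cross terms cancel for
    Hermitian \<Delta>. This keeps the small factor \<open>norm (u - y)\<close> in the noise
    bound.\<close>
  moreover have "inner (u + y) (\<Delta> *v (u - y)) = inner u (\<Delta> *v u) - inner y (\<Delta> *v y)"
    using hermitian_inner_commute[OF herm, of u y]
    by (simp add: matrix_vector_mult_diff_distrib inner_diff inner_add inner_commute)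
  moreover have "inner (u + y) (\<Delta> *v (u - y)) \<le> norm (u + y) * (D * norm (u - y))"
    using norm_cauchy_schwarz[of "u + y" "\<Delta> *v (u - y)"]
      mult_left_mono[OF norm_matrix_le_op_norm[of \<Delta> "u - y"], of "norm (u + y)"]
    by (simp add: D_def)
  ultimately have main: "n\<^sup>2 - c\<^sup>2 \<le> D * (norm (u - y) * norm (u + y))"
    by (simp add: mult_ac)
  have minus: "(norm (u - y))\<^sup>2 = 2 * (n - c)" and plus: "(norm (u + y))\<^sup>2 = 2 * (n + c)"
    using norm_u norm_y c
    by (simp_all add: power2_norm_eq_inner inner_diff inner_add inner_commute n_def)
  \<comment> \<open>By \<open>minus\<close> and \<open>plus\<close>, the square of \<open>P\<close>
    is 4 (n - c) (n + c), so \<open>main\<close> becomes quadratic in \<open>P\<close> and one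
    factor cancels.\<close>
  define P where "P = norm (u - y) * norm (u + y)"
  have "P\<^sup>2 = 4 * (n\<^sup>2 - c\<^sup>2)"
    unfolding P_def power_mult_distrib minus plus by (simp add: power2_eq_square algebra_simps)
  then have "P * P \<le> (4 * D) * P" using main by (simp add: P_def power2_eq_square)
  moreover have "P \<ge> 0" by (simp add: P_def)
  ultimately have P: "P \<le> 4 * D"
    using D by (cases "P = 0") (auto simp: mult_le_cancel_right)
  \<comment> \<open>Alignment gives \<open>c \<ge> 0\<close>, so \<open>u + y\<close> cannot be
    short and can be divided out.\<close>
  have "(sqrt n)\<^sup>2 \<le> (norm (u + y))\<^sup>2" using plus n c0 by simp
  then have "sqrt n \<le> norm (u + y)" by (rule power2_le_imp_le) simp
  then have "norm (u - y) * sqrt n \<le> P" unfolding P_def by (intro mult_left_mono) auto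
  with P n show ?thesis by (simp add: field_simps n_def D_def y_def)
qed

lemma leading_eigenvector_scaleR:
  assumes "leading_eigenvector A u" and "r \<noteq> 0"
  shows "leading_eigenvector A (r *\<^sub>R u)"
proof -
  have "eigenpair A l (r *\<^sub>R u)" if "eigenpair A l u" for l
    using that assms(2) unfolding eigenpair_def matrix_mult_scaleR_right
    by (simp add: vec_eq_iff)
  then show ?thesis using assms(1) unfolding leading_eigenvector_def by blast
qed

lemma cmod_eig_estimator: "herm_inner a u \<noteq> 0 \<Longrightarrow> cmod (eig_estimator a u $ j) = 1"
  by (simp add: eig_estimator_def norm_divide)

lemma corr_gap_eig_estimator:
  fixes u z :: "complex ^ 'n"
  assumes z: "z \<in> torus" and herm: "hermitian \<Delta>"
    and u: "leading_eigenvector (outer_prod z z + \<Delta>) u" and a: "herm_inner a u \<noteq> 0"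
  shows "corr_gap (eig_estimator a u) z \<le> (8 * op_norm \<Delta> / sqrt (real CARD('n)))\<^sup>2"
proof -
  have u0: "norm u > 0" using u by (auto simp: leading_eigenvector_def eigenpair_def)
  \<comment> \<open>Rescales \<open>u\<close> to the norm of a torus point; a positive factor leaves
    the rounded entries unchanged.\<close>
  define r where "r = sqrt (real CARD('n)) / norm u"
  have r: "r > 0" using u0 by (simp add: r_def)
  define x where "x = r *\<^sub>R u"
  have norm_x: "(norm x)\<^sup>2 = real CARD('n)" using u0 by (simp add: x_def r_def)
  obtain p where p: "cmod p = 1" "herm_inner z x = of_real (cmod (herm_inner z x)) * p"
    by (rule d2_optimal_phase)
  have x: "x $ j = of_real r * u $ j" for j by (simp add: x_def) (simp add: scaleR_conv_of_real)
  have est: "eig_estimator a u $ j = sgn (x $ j)" if "x $ j \<noteq> 0" for j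
    using that r by (simp add: eig_estimator_def x sgn_eq norm_mult)
  have le: "norm (x - p *s z) \<le> 4 * op_norm \<Delta> / sqrt (real CARD('n))"
    using spectral_perturbation[OF z herm leading_eigenvector_scaleR[OF u] _ p(1)] r p(2) norm_x
    by (simp add: x_def)
  have "corr_gap (eig_estimator a u) z \<le> (2 * norm (x - p *s z))\<^sup>2"
    by (rule corr_gap_rounding[OF z p(1) _ est]) (simp add: cmod_eig_estimator[OF a])
  also have "\<dots> \<le> (8 * op_norm \<Delta> / sqrt (real CARD('n)))\<^sup>2"
    using le by (intro power_mono) auto
  finally show ?thesis .
qed

section \<open>One step of the power method\<close>

lemma cmod_normalize_entries_le: "cmod (normalize_entries w $ j) \<le> 1"
  by (simp add: normalize_entries_def norm_divide)

text \<open>Both the hypothesis and the conclusion use the gap, so steps can be chained even when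
  entries vanish. The gap bound \<open>n / 4\<close> is exactly the condition c \<ge> 7/8.\<close>

lemma corr_gap_gpm_step:
  fixes x z :: "complex ^ 'n"
  assumes z: "z \<in> torus" and step: "\<alpha> \<ge> 0" and gap: "corr_gap x z \<le> n / 4"
    and n: "n = real CARD('n)"
    and x': "x' = normalize_entries ((mat 1 + (\<alpha> / n) *\<^sub>R (outer_prod z z + \<Delta>)) *v x)"
  shows "corr_gap x' z \<le> (16 * (\<alpha> * op_norm \<Delta> + n) / ((7 * \<alpha> + 8) * n) * d2 x z
           + 2 * \<alpha> / (7 * \<alpha> + 8) * (8 * op_norm \<Delta> / sqrt n))\<^sup>2"
proof -
  have n0: "n > 0" by (simp add: n)
  define D where "D = op_norm \<Delta>"
  have D: "D \<ge> 0" by (simp add: D_def op_norm_nonneg)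
  obtain p where p: "cmod p = 1" "d2 x z = norm (x - p *s z)"
    "herm_inner z x = of_real (cmod (herm_inner z x)) * p"
    by (rule d2_optimal_phase)
  define y where "y = p *s z"
  define d where "d = d2 x z"
  define c where "c = cmod (herm_inner z x) / n"
  have d: "norm (x - y) = d" "d \<ge> 0" by (simp_all add: d_def p(2) y_def)
  have "c \<ge> 7 / 8" using gap n0 by (simp add: corr_gap_def c_def n[symmetric] field_simps)
  then have s: "\<alpha> * c + 1 \<ge> (7 * \<alpha> + 8) / 8"
    using mult_left_mono[of "7/8" c \<alpha>] step by simp
  define s where "s = \<alpha> * c + 1"
  have s0: "s > 0" using s step by (simp add: s_def)
  define w where "w = (mat 1 + (\<alpha> / n) *\<^sub>R (outer_prod z z + \<Delta>)) *v x"
  have scaleR_mult: "(r *\<^sub>R A) *v x = r *\<^sub>R (A *v x)" for r and A :: "complex ^ 'n ^ 'n"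
    by (simp add: vec_eq_iff matrix_vector_mult_def scaleR_sum_right)
  \<comment> \<open>The rank-one part sends \<open>x\<close> to \<open>(n * c) *\<^sub>R y\<close>,
    since \<open>p\<close> is the phase of the correlation.\<close>
  have "w = x + (\<alpha> * c) *\<^sub>R y + (\<alpha> / n) *\<^sub>R (\<Delta> *v x)"
    using n0 by (simp add: w_def matrix_vector_mult_add_rdistrib scaleR_mult
        outer_prod_phase[OF p(3)] y_def c_def scaleR_add_right)
  then have "w - s *\<^sub>R y = (x - y) + (\<alpha> / n) *\<^sub>R (\<Delta> *v (x - y)) + (\<alpha> / n) *\<^sub>R (\<Delta> *v y)"
    by (simp add: s_def matrix_vector_mult_diff_distrib algebra_simps)
  also have "norm \<dots> \<le> norm (x - y) + \<alpha> / n * norm (\<Delta> *v (x - y)) + \<alpha> / n * norm (\<Delta> *v y)"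
    by (intro order_trans[OF norm_triangle_ineq] add_mono) (use step n0 in auto)
  also have "\<dots> \<le> d + \<alpha> / n * (D * d) + \<alpha> / n * (D * sqrt n)"
  proof -
    have "norm y = sqrt n"
      using norm_torus[OF torus_scale[OF p(1) z]] by (simp add: y_def n real_sqrt_unique)
    then show ?thesis
      using norm_matrix_le_op_norm[of \<Delta> "x - y"] norm_matrix_le_op_norm[of \<Delta> y] step n0
      by (intro add_mono mult_left_mono) (auto simp: d D_def)
  qed
  finally have w: "norm (w - s *\<^sub>R y) \<le> d + \<alpha> / n * (D * d) + \<alpha> / n * (D * sqrt n)" .
  \<comment> \<open>Rounding ignores the positive factor \<open>1 / s\<close>, so it may be applied
    to the rescaled vector, which is close to \<open>y\<close>.\<close>
  have "(1 / s) *\<^sub>R w - y = (1 / s) *\<^sub>R (w - s *\<^sub>R y)"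
    using s0 by (simp add: algebra_simps)
  then have "norm ((1 / s) *\<^sub>R w - y) = norm (w - s *\<^sub>R y) / s"
    using s0 by simp
  also have "\<dots> \<le> norm (w - s *\<^sub>R y) / ((7 * \<alpha> + 8) / 8)"
    using s step by (intro divide_left_mono) (auto simp: s_def)
  also have "\<dots> \<le> (d + \<alpha> / n * (D * d) + \<alpha> / n * (D * sqrt n)) / ((7 * \<alpha> + 8) / 8)"
    using w step by (intro divide_right_mono) auto
  finally have "2 * norm ((1 / s) *\<^sub>R w - y)
      \<le> 2 * ((d + \<alpha> / n * (D * d) + \<alpha> / n * (D * sqrt n)) / ((7 * \<alpha> + 8) / 8))"
    by (rule mult_left_mono) simp
  \<comment> \<open>The 16 is the 2 from rounding times the 8 from the lower bound on
    \<open>s\<close>. In the noise term it is split as 2 times 8 to expose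
    \<open>8 * D / sqrt n\<close>.\<close>
  also have "\<dots> = 16 * (\<alpha> * D + n) / ((7 * \<alpha> + 8) * n) * d + 2 * \<alpha> / (7 * \<alpha> + 8) * (8 * D / sqrt n)"
  proof -
    have *: "2 * ((d + \<alpha> / n * (D * d) + r) / (q / 8)) = 16 * (\<alpha> * D + n) / (q * n) * d + 16 * r / q"
      if "q > 0" for q r :: real
      using that n0 by (simp add: field_simps)
    have "\<alpha> / n * (D * sqrt n) = \<alpha> * D / sqrt n"
      using n0 by (simp add: real_div_sqrt field_simps)
    then show ?thesis using *[of "7 * \<alpha> + 8" "\<alpha> * D / sqrt n"] step by simp
  qed
  finally have bound: "2 * norm ((1 / s) *\<^sub>R w - p *s z) \<le> \<dots>" by (simp add: y_def)
  have "corr_gap x' z \<le> (2 * norm ((1 / s) *\<^sub>R w - p *s z))\<^sup>2"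
  proof (rule corr_gap_rounding[OF z p(1)])
    show "cmod (x' $ j) \<le> 1" for j by (simp add: x' cmod_normalize_entries_le)
    have *: "((1 / s) *\<^sub>R w) $ j = of_real (1 / s) * w $ j" for j
      unfolding vector_scaleR_component by (rule scaleR_conv_of_real)
    show "x' $ j = sgn (((1 / s) *\<^sub>R w) $ j)" if "((1 / s) *\<^sub>R w) $ j \<noteq> 0" for j
      using that s0 unfolding x' w_def[symmetric] *
      by (simp add: normalize_entries_def sgn_eq norm_mult norm_divide)
  qed
  also have "\<dots> \<le> (16 * (\<alpha> * D + n) / ((7 * \<alpha> + 8) * n) * d + 2 * \<alpha> / (7 * \<alpha> + 8) * (8 * D / sqrt n))\<^sup>2"
    using bound by (intro power_mono) auto
  finally show ?thesis by (simp add: D_def d_def)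
qed

section \<open>Induction along the iterates\<close>

theorem theorem1:
  fixes zs u a :: "complex ^ 'n"
    and \<Delta> C :: "complex ^ 'n ^ 'n"
    and \<alpha> \<mu> \<nu> n :: real
    and z :: "nat \<Rightarrow> complex ^ 'n"
  assumes n: "n = real CARD('n)"
    and zs: "zs \<in> torus"
    and herm: "hermitian \<Delta>"
    and diag: "\<And>j. \<Delta> $ j $ j = 0"
    and C: "C = outer_prod zs zs + \<Delta>"
    and noise: "op_norm \<Delta> \<le> n / 16"
    and step: "\<alpha> \<ge> 2"
    and u: "leading_eigenvector C u"
    and a: "herm_inner a u \<noteq> 0"
    and z: "z = gpm C \<alpha> (eig_estimator a u)"
    and \<mu>: "\<mu> = 16 * (\<alpha> * op_norm \<Delta> + n) / ((7 * \<alpha> + 8) * n)"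
    and \<nu>: "\<nu> = 2 * \<alpha> / (7 * \<alpha> + 8)"
  shows "\<mu> < 1 \<and>
    (\<forall>k. d2 (z (k + 1)) zs
           \<le> \<mu> ^ (k + 1) * d2 (z 0) zs + \<nu> / (1 - \<mu>) * (8 * op_norm \<Delta> / sqrt n)
       \<and> \<mu> ^ (k + 1) * d2 (z 0) zs + \<nu> / (1 - \<mu>) * (8 * op_norm \<Delta> / sqrt n)
           \<le> (\<mu> ^ (k + 1) + \<nu> / (1 - \<mu>)) * (8 * op_norm \<Delta> / sqrt n))"
proof -
  define D where "D = op_norm \<Delta>"
  define B where "B = 8 * D / sqrt n"
  have n0: "n > 0" by (simp add: n)
  have D: "0 \<le> D" by (simp add: D_def op_norm_nonneg)
  have B0: "0 \<le> B" using D n0 by (simp add: B_def)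
  \<comment> \<open>The noise level n/16 is chosen for this: the square of \<open>sqrt n / 2\<close>
    is the threshold \<open>n / 4\<close> of \<open>corr_gap_gpm_step\<close>.\<close>
  have half: "B \<le> sqrt n / 2"
    using noise n0 by (simp add: B_def D_def field_simps)
  have "\<alpha> * D \<le> \<alpha> * (n / 16)" using noise step by (intro mult_left_mono) (auto simp: D_def)
  then have "16 * (\<alpha> * D + n) \<le> (\<alpha> + 16) * n" by (simp add: algebra_simps)
  then have "\<mu> \<le> (\<alpha> + 16) * n / ((7 * \<alpha> + 8) * n)"
    unfolding \<mu> D_def[symmetric] using n0 step by (intro divide_right_mono) auto
  also have "\<dots> = (\<alpha> + 16) / (7 * \<alpha> + 8)" using n0 by simp
  finally have mu_le: "\<mu> \<le> \<dots>" .
  moreover have "\<dots> < 1" using step by simp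
  ultimately have mu1: "\<mu> < 1" by simp
  have mu0: "0 \<le> \<mu>" using n0 step D by (simp add: \<mu> D_def[symmetric])
  have nu0: "0 \<le> \<nu>" using step by (simp add: \<nu>)
  \<comment> \<open>The sum is (3 \<alpha> + 16) / (7 \<alpha> + 8), which for positive \<alpha> is
    at most 1 exactly when \<alpha> \<ge> 2.\<close>
  have "\<mu> + \<nu> \<le> (\<alpha> + 16) / (7 * \<alpha> + 8) + 2 * \<alpha> / (7 * \<alpha> + 8)" using mu_le by (simp add: \<nu>)
  also have "\<dots> \<le> 1" using step by (simp add: add_divide_distrib[symmetric])
  finally have munu: "\<mu> + \<nu> \<le> 1" .
  have unit: "cmod (z k $ j) \<le> 1" for k j
    by (cases k) (simp_all add: z cmod_eig_estimator[OF a] cmod_normalize_entries_le)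
  have d2_gap: "d2 (z k) zs \<le> b" if "corr_gap (z k) zs \<le> b\<^sup>2" "0 \<le> b" for k b
    using order_trans[OF d2_sq_le_corr_gap[OF zs unit] that(1)] that(2) by (rule power2_le_imp_le)
  have gap0: "corr_gap (z 0) zs \<le> B\<^sup>2"
    using corr_gap_eig_estimator[OF zs herm u[unfolded C] a] by (simp add: z B_def D_def n)
  have gapSuc: "corr_gap (z (Suc k)) zs \<le> (\<mu> * d2 (z k) zs + \<nu> * B)\<^sup>2"
    if "corr_gap (z k) zs \<le> n / 4" for k
    unfolding \<mu> \<nu> B_def D_def
    by (rule corr_gap_gpm_step[OF zs _ that n]) (use step in \<open>simp_all add: z C n\<close>)
  have quarter: "(sqrt n / 2)\<^sup>2 = n / 4" using n0 by (simp add: power_divide)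
  \<comment> \<open>The invariant: \<open>d2 (z k) zs\<close> and \<open>B\<close> are both at most
    \<open>sqrt n / 2\<close>, and \<open>munu\<close> keeps their combination with weights \<mu>
    and \<nu> below the same value.\<close>
  have gap: "corr_gap (z k) zs \<le> n / 4" for k
  proof (induction k)
    case 0
    then show ?case using gap0 power_mono[OF half B0, of 2] by (simp add: quarter)
  next
    case (Suc k)
    have "d2 (z k) zs \<le> sqrt n / 2" using Suc n0 by (intro d2_gap) (simp_all add: quarter)
    then have "\<mu> * d2 (z k) zs + \<nu> * B \<le> \<mu> * (sqrt n / 2) + \<nu> * (sqrt n / 2)"
      using half mu0 nu0 by (intro add_mono mult_left_mono)
    also have "\<dots> = (\<mu> + \<nu>) * (sqrt n / 2)" by (simp add: algebra_simps)
    also have "\<dots> \<le> sqrt n / 2" using mult_right_mono[OF munu, of "sqrt n / 2"] n0 by simp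
    finally have "(\<mu> * d2 (z k) zs + \<nu> * B)\<^sup>2 \<le> (sqrt n / 2)\<^sup>2"
      using mu0 nu0 B0 d2_nonneg[of "z k" zs] by (intro power_mono) auto
    with gapSuc[OF Suc] show ?case by (simp add: quarter)
  qed
  have contraction: "d2 (z (Suc k)) zs \<le> \<mu> * d2 (z k) zs + \<nu> * B" for k
    using gapSuc[OF gap] mu0 nu0 B0 d2_nonneg[of "z k" zs] by (intro d2_gap) auto
  \<comment> \<open>Unrolls the contraction from \<open>k = 0\<close>;
    \<open>\<nu> / (1 - \<mu>)\<close> is the fixed point of t -> \<mu> t + \<nu>, so the noise term
    reproduces itself.\<close>
  have bound: "d2 (z k) zs \<le> \<mu> ^ k * d2 (z 0) zs + \<nu> / (1 - \<mu>) * B" for k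
  proof (induction k)
    case 0
    then show ?case using mu1 nu0 B0 by simp
  next
    case (Suc k)
    have "d2 (z (Suc k)) zs \<le> \<mu> * (\<mu> ^ k * d2 (z 0) zs + \<nu> / (1 - \<mu>) * B) + \<nu> * B"
      using contraction[of k] mult_left_mono[OF Suc mu0] by simp
    also have "\<dots> = \<mu> ^ Suc k * d2 (z 0) zs + (\<mu> * (\<nu> / (1 - \<mu>)) + \<nu>) * B"
      by (simp add: algebra_simps)
    also have "\<mu> * (\<nu> / (1 - \<mu>)) + \<nu> = \<nu> / (1 - \<mu>)" using mu1 by (simp add: field_simps)
    finally show ?case .
  qed
  \<comment> \<open>The second inequality of the claim: the estimator already satisfies
    \<open>d2 (z 0) zs \<le> B\<close>.\<close>
  have init: "\<mu> ^ k * d2 (z 0) zs + c * B \<le> (\<mu> ^ k + c) * B" for k c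
    using mult_left_mono[OF d2_gap[OF gap0 B0], of "\<mu> ^ k"] mu0 by (simp add: distrib_right)
  show ?thesis
    unfolding D_def[symmetric] B_def[symmetric] using mu1 bound init by blast
qed

end
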